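(* Let $G$ be a simple graph with $n$ vertices, $m$ edges, minimum degree $\delta$ and clique number $\omega$, and let $\alpha \in [0,1]$. Then $$\alpha\delta - \sqrt{2m(1-\alpha)\left(1 - \frac{1}{\omega}\right)} \le \lambda_n(A_\alpha(G)) \le \alpha\delta + \sqrt{2m(1-\alpha)\left(1 - \frac{1}{\omega}\right)}.$$
   Context: For a simple graph $G$ with adjacency matrix $A(G)$ and diagonal degree matrix $D(G)$, and $\alpha\in[0,1]$, define $A_\alpha(G) = \alpha D(G) + (1-\alpha)A(G)$, with eigenvalues ordered $\lambda_1(A_\alpha(G)) \ge \dots \ge \lambda_n(A_\alpha(G))$. The clique number $\omega$ is the maximum number of vertices of a complete subgraph of $G$. *)

theory Defs
  imports Complex_Main "HOL-Computational_Algebra.Polynomial" "Jordan_Normal_Form.Char_Poly"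
begin

definition simple_graph :: "'a set \<Rightarrow> 'a set set \<Rightarrow> bool" where
  "simple_graph V E \<longleftrightarrow> finite V \<and> V \<noteq> {} \<and> (\<forall>e\<in>E. e \<subseteq> V \<and> card e = 2)"

definition vertex_degree :: "'a set set \<Rightarrow> 'a \<Rightarrow> nat" where
  "vertex_degree E v = card {e \<in> E. v \<in> e}"

definition min_degree :: "'a set \<Rightarrow> 'a set set \<Rightarrow> nat" where
  "min_degree V E = Min (vertex_degree E ` V)"

definition is_clique :: "'a set \<Rightarrow> 'a set set \<Rightarrow> 'a set \<Rightarrow> bool" where
  "is_clique V E C \<longleftrightarrow> C \<subseteq> V \<and> (\<forall>u\<in>C. \<forall>v\<in>C. u \<noteq> v \<longrightarrow> {u, v} \<in> E)"

definition clique_number :: "'a set \<Rightarrow> 'a set set \<Rightarrow> nat" where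
  "clique_number V E = Max (card ` {C. is_clique V E C})"

text \<open>In the matrices below, the list \<open>vs\<close> enumerates the vertex set without repetition;
  row and column \<open>i\<close> belong to the vertex \<open>vs ! i\<close>.\<close>

definition adjacency_matrix :: "'a list \<Rightarrow> 'a set set \<Rightarrow> real mat" where
  "adjacency_matrix vs E =
     mat (length vs) (length vs) (\<lambda>(i, j). if {vs ! i, vs ! j} \<in> E then 1 else 0)"

definition degree_matrix :: "'a list \<Rightarrow> 'a set set \<Rightarrow> real mat" where
  "degree_matrix vs E =
     mat (length vs) (length vs) (\<lambda>(i, j). if i = j then real (vertex_degree E (vs ! i)) else 0)"

definition A_alpha :: "real \<Rightarrow> 'a list \<Rightarrow> 'a set set \<Rightarrow> real mat" where
  "A_alpha \<alpha> vs E = \<alpha> \<cdot>\<^sub>m degree_matrix vs E + (1 - \<alpha>) \<cdot>\<^sub>m adjacency_matrix vs E"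

text \<open>The \<open>k\<close>-th largest eigenvalue, for \<open>1 \<le> k \<le> n\<close>, counted with algebraic multiplicity.
  It is meant for real symmetric \<open>n \<times> n\<close> matrices, whose characteristic polynomial
  has exactly \<open>n\<close> real roots with multiplicity.\<close>

definition eigenvalue_desc :: "nat \<Rightarrow> real mat \<Rightarrow> real" where
  "eigenvalue_desc k A = rev (sorted_list_of_multiset (proots (char_poly A))) ! (k - 1)"

end

theory Submission
  imports Defs "HOL-Analysis.Function_Topology" "HOL-Analysis.Convex"
begin

text \<open>The least eigenvalue of a symmetric matrix is the minimum of its quadratic form on the unit
  sphere, hence at most every diagonal entry; this gives the upper bound. For the lower bound, take
  an eigenvector \<open>x\<close> of the least eigenvalue. The diagonal part of its quadratic form is at least
  \<open>\<alpha> \<delta> |x|\<^sup>2\<close>. For the adjacency part, the Cauchy-Schwarz inequality over the \<open>2 m\<close> ordered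
  adjacent pairs bounds \<open>(x\<^sup>T A x)\<^sup>2\<close> by \<open>2 m\<close> times the adjacency form of the vector of squares
  \<open>x\<^sub>i\<^sup>2\<close>, and the Motzkin-Straus inequality bounds the latter by \<open>(1 - 1/\<omega>) |x|\<^sup>4\<close>.\<close>

section \<open>Quadratic forms\<close>

text \<open>Functions on an arbitrary index set replace vectors, so that one notion serves both
  matrix entries and 0/1 relations. Values of \<open>x\<close> outside \<open>I\<close> do not
  count.\<close>

definition quad_form :: "'i set \<Rightarrow> ('i \<Rightarrow> 'i \<Rightarrow> real) \<Rightarrow> ('i \<Rightarrow> real) \<Rightarrow> real" where
  "quad_form I a x = (\<Sum>i\<in>I. \<Sum>j\<in>I. a i j * x i * x j)"

lemma quad_form_altdef: "quad_form I a x = (\<Sum>i\<in>I. x i * (\<Sum>j\<in>I. a i j * x j))"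
  unfolding quad_form_def by (simp add: sum_distrib_left mult_ac)

lemma quad_form_cong:
  assumes "\<And>i. i \<in> I \<Longrightarrow> x i = y i"
  shows "quad_form I a x = quad_form I a y"
  unfolding quad_form_def by (intro sum.cong refl) (simp add: assms)

lemma quad_form_scale: "quad_form I a (\<lambda>i. c * x i) = c\<^sup>2 * quad_form I a x"
  unfolding quad_form_def by (simp add: sum_distrib_left power2_eq_square mult_ac)

text \<open>Restricting the form to a line gives a quadratic polynomial in \<open>t\<close>;
  symmetry merges the two mixed terms. This yields the first-order condition at a minimizer and the
  weight shift in the Motzkin-Straus argument.\<close>

lemma quad_form_add_scaled:
  assumes sym: "\<And>i j. i \<in> I \<Longrightarrow> j \<in> I \<Longrightarrow> a i j = a j i"
  shows "quad_form I a (\<lambda>i. x i + t * d i) =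
    quad_form I a x + 2 * t * (\<Sum>i\<in>I. d i * (\<Sum>j\<in>I. a i j * x j)) + t\<^sup>2 * quad_form I a d"
proof -
  have swap: "(\<Sum>i\<in>I. \<Sum>j\<in>I. a i j * x i * d j) = (\<Sum>i\<in>I. \<Sum>j\<in>I. a i j * d i * x j)"
    by (subst sum.swap, intro sum.cong refl) (simp add: sym mult_ac)
  have "quad_form I a (\<lambda>i. x i + t * d i) =
    (\<Sum>i\<in>I. \<Sum>j\<in>I. a i j * x i * x j + t * (a i j * x i * d j) + t * (a i j * d i * x j)
      + t\<^sup>2 * (a i j * d i * d j))"
    unfolding quad_form_def by (intro sum.cong refl) (simp add: algebra_simps power2_eq_square)
  also have "\<dots> = quad_form I a x + t * (\<Sum>i\<in>I. \<Sum>j\<in>I. a i j * x i * d j)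
      + t * (\<Sum>i\<in>I. \<Sum>j\<in>I. a i j * d i * x j) + t\<^sup>2 * quad_form I a d"
    unfolding quad_form_def by (simp add: sum.distrib sum_distrib_left)
  also have "\<dots> = quad_form I a x + 2 * t * (\<Sum>i\<in>I. \<Sum>j\<in>I. a i j * d i * x j)
      + t\<^sup>2 * quad_form I a d"
    unfolding swap by simp
  also have "(\<Sum>i\<in>I. \<Sum>j\<in>I. a i j * d i * x j) = (\<Sum>i\<in>I. d i * (\<Sum>j\<in>I. a i j * x j))"
    by (simp add: sum_distrib_left mult_ac)
  finally show ?thesis .
qed

text \<open>The polynomial in \<open>t\<close> vanishes at 0 and is nowhere negative, so 0 is a
  minimum and the derivative \<open>2 * l\<close> there must be zero.\<close>

lemma linear_coeff_eq_0_if_nonneg: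
  fixes l c :: real
  assumes "\<And>t. 0 \<le> 2 * t * l + t\<^sup>2 * c"
  shows "l = 0"
proof (rule ccontr)
  assume l: "l \<noteq> 0"
  \<comment> \<open>At \<open>t = - l / b\<close> the polynomial equals
    \<open>(l / b)\<^sup>2 * (c - 2 * b)\<close>. This \<open>b\<close> is positive and exceeds
    \<open>c / 2\<close> whatever the sign of \<open>c\<close>.\<close>
  define b where "b = \<bar>c\<bar> + 1"
  have b: "b > 0" "c < 2 * b" by (auto simp: b_def)
  have "0 \<le> 2 * (- l / b) * l + (- l / b)\<^sup>2 * c" by (rule assms)
  also have "\<dots> = (l\<^sup>2 / b\<^sup>2) * (c - 2 * b)"
    using b by (simp add: field_simps power2_eq_square)
  also have "\<dots> < 0" using l b by (intro mult_pos_neg) auto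
  finally show False by simp
qed

section \<open>Minimizers of quadratic forms on the unit sphere\<close>

lemma sum_of_bool_mult:
  fixes f :: "'i \<Rightarrow> real"
  assumes "finite I" "u \<in> I"
  shows "(\<Sum>i\<in>I. of_bool (i = u) * f i) = f u"
    and "(\<Sum>i\<in>I. f i * of_bool (i = u)) = f u"
  using assms by (simp_all add: of_bool_def if_distrib if_distribR sum.delta cong: if_cong)

text \<open>Pinning the coordinates outside \<open>I\<close> to 0 places the sphere inside a product
  of compact sets, so Tychonoff's theorem gives compactness in the product topology on all
  functions.\<close>

lemma compact_unit_sphere_fun:
  assumes "finite I"
  shows "compact {x :: 'i \<Rightarrow> real. (\<forall>i. i \<notin> I \<longrightarrow> x i = 0) \<and> (\<Sum>i\<in>I. (x i)\<^sup>2) = 1}"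
    (is "compact ?S")
proof -
  define K where "K = (\<Pi>\<^sub>E i\<in>(UNIV::'i set). if i \<in> I then {-1..1::real} else {0})"
  have "compactin (product_topology (\<lambda>i. euclidean) UNIV) K"
    unfolding K_def compactin_PiE by (auto simp: compactin_euclidean_iff)
  hence K: "compact K"
    unfolding euclidean_product_topology compactin_euclidean_iff .
  have "continuous_on UNIV (\<lambda>x :: 'i \<Rightarrow> real. \<Sum>i\<in>I. (x i)\<^sup>2)"
    by (intro continuous_intros continuous_on_product_coordinates)
  hence "closed ((\<lambda>x :: 'i \<Rightarrow> real. \<Sum>i\<in>I. (x i)\<^sup>2) -` {1})"
    by (intro closed_vimage) auto
  hence "compact (K \<inter> (\<lambda>x. \<Sum>i\<in>I. (x i)\<^sup>2) -` {1})"
    by (rule compact_Int_closed[OF K])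
  also have "K \<inter> (\<lambda>x. \<Sum>i\<in>I. (x i)\<^sup>2) -` {1} = ?S"
  proof (intro equalityI subsetI)
    fix x assume "x \<in> K \<inter> (\<lambda>x. \<Sum>i\<in>I. (x i)\<^sup>2) -` {1}"
    thus "x \<in> ?S" by (auto simp: K_def PiE_iff split: if_splits)
  next
    fix x assume x: "x \<in> ?S"
    have "x i \<in> {-1..1}" if "i \<in> I" for i
    proof -
      have "(x i)\<^sup>2 \<le> (\<Sum>i\<in>I. (x i)\<^sup>2)" using that assms by (intro member_le_sum) auto
      hence "(x i)\<^sup>2 \<le> 1" using x by simp
      thus ?thesis by (simp add: abs_square_le_1 abs_le_iff)
    qed
    thus "x \<in> K \<inter> (\<lambda>x. \<Sum>i\<in>I. (x i)\<^sup>2) -` {1}" using x by (auto simp: K_def PiE_iff)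
  qed
  finally show ?thesis .
qed

text \<open>A continuous function attains its minimum on the compact sphere; homogeneity of degree 2
  carries the inequality from the sphere to every \<open>y\<close>.\<close>

lemma quad_form_minimizer_exists:
  fixes a :: "'i \<Rightarrow> 'i \<Rightarrow> real"
  assumes "finite I" "I \<noteq> {}"
  obtains x where "(\<Sum>i\<in>I. (x i)\<^sup>2) = 1"
    and "\<And>y. quad_form I a x * (\<Sum>i\<in>I. (y i)\<^sup>2) \<le> quad_form I a y"
proof -
  define S where "S = {x :: 'i \<Rightarrow> real. (\<forall>i. i \<notin> I \<longrightarrow> x i = 0) \<and> (\<Sum>i\<in>I. (x i)\<^sup>2) = 1}"
  have "compact S" unfolding S_def by (rule compact_unit_sphere_fun[OF assms(1)])
  moreover obtain u where u: "u \<in> I" using assms by auto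
  hence "(\<lambda>i. of_bool (i = u)) \<in> S"
    using assms(1) sum_of_bool_mult(1)[of I u "\<lambda>_. 1"]
    by (auto simp: S_def power2_eq_square simp flip: of_bool_conj)
  hence "S \<noteq> {}" by auto
  moreover have "continuous_on S (quad_form I a)"
    unfolding quad_form_def
    by (intro continuous_intros continuous_on_subset[OF continuous_on_product_coordinates]) auto
  ultimately obtain x where x: "x \<in> S" "\<And>y. y \<in> S \<Longrightarrow> quad_form I a x \<le> quad_form I a y"
    using continuous_attains_inf by metis
  show ?thesis
  proof (rule that)
    show "(\<Sum>i\<in>I. (x i)\<^sup>2) = 1" using x(1) by (simp add: S_def)
    fix y :: "'i \<Rightarrow> real"
    define s where "s = (\<Sum>i\<in>I. (y i)\<^sup>2)"
    have s: "s \<ge> 0" unfolding s_def by (intro sum_nonneg) auto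
    show "quad_form I a x * (\<Sum>i\<in>I. (y i)\<^sup>2) \<le> quad_form I a y"
    proof (cases "s = 0")
      case True
      hence "\<forall>i\<in>I. y i = 0"
        unfolding s_def using assms(1) by (subst (asm) sum_nonneg_eq_0_iff) auto
      thus ?thesis by (simp add: quad_form_def)
    next
      case False
      \<comment> \<open>Besides being normalized, \<open>y\<close> is cut off outside
        \<open>I\<close>, since membership in \<open>S\<close> requires zeros there; the form does
        not see the change.\<close>
      define z where "z = (\<lambda>i. if i \<in> I then 1 / sqrt s * y i else 0)"
      have "(\<Sum>i\<in>I. (z i)\<^sup>2) = (\<Sum>i\<in>I. (1 / s) * (y i)\<^sup>2)"
        using s by (intro sum.cong refl) (simp add: z_def power_mult_distrib power_divide)
      also have "\<dots> = 1" using False unfolding s_def by (simp flip: sum_divide_distrib)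
      finally have "z \<in> S" by (simp add: S_def z_def)
      hence "quad_form I a x \<le> quad_form I a z" by (rule x(2))
      also have "\<dots> = quad_form I a (\<lambda>i. 1 / sqrt s * y i)"
        by (intro quad_form_cong) (simp add: z_def)
      also have "\<dots> = 1 / s * quad_form I a y"
        unfolding quad_form_scale using s by (simp add: power_divide)
      finally show ?thesis using s False by (simp add: field_simps flip: s_def)
    qed
  qed
qed

text \<open>The Rayleigh principle: a minimizer of the form on the unit sphere is an eigenvector,
  and the minimum is its eigenvalue.\<close>

lemma symmetric_min_eigenvector_exists:
  fixes a :: "'i \<Rightarrow> 'i \<Rightarrow> real"
  assumes "finite I" "I \<noteq> {}" and sym: "\<And>i j. i \<in> I \<Longrightarrow> j \<in> I \<Longrightarrow> a i j = a j i"
  obtains \<mu> x where "\<exists>i\<in>I. x i \<noteq> 0"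
    and "\<And>i. i \<in> I \<Longrightarrow> (\<Sum>j\<in>I. a i j * x j) = \<mu> * x i"
    and "\<And>y. \<mu> * (\<Sum>i\<in>I. (y i)\<^sup>2) \<le> quad_form I a y"
proof -
  obtain x where x: "(\<Sum>i\<in>I. (x i)\<^sup>2) = 1"
    and min: "\<And>y. quad_form I a x * (\<Sum>i\<in>I. (y i)\<^sup>2) \<le> quad_form I a y"
    using quad_form_minimizer_exists[OF assms(1,2)] by metis
  define \<mu> where "\<mu> = quad_form I a x"
  \<comment> \<open>\<open>b\<close> represents \<open>a\<close> minus \<open>\<mu>\<close> times
    the identity. Its form is nonnegative and vanishes at \<open>x\<close>, so its first-order term
    at \<open>x\<close> is zero in every direction.\<close>
  define b where "b = (\<lambda>i j. a i j - \<mu> * of_bool (j = i))"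
  have b_apply: "(\<Sum>j\<in>I. b i j * y j) = (\<Sum>j\<in>I. a i j * y j) - \<mu> * y i" if "i \<in> I" for i y
    using sum_of_bool_mult(1)[OF assms(1) that, of y]
    by (simp add: b_def algebra_simps sum_subtractf flip: sum_distrib_left)
  have b_form: "quad_form I b y = quad_form I a y - \<mu> * (\<Sum>i\<in>I. (y i)\<^sup>2)" for y
  proof -
    have "quad_form I b y = (\<Sum>i\<in>I. y i * ((\<Sum>j\<in>I. a i j * y j) - \<mu> * y i))"
      unfolding quad_form_altdef by (intro sum.cong refl) (simp add: b_apply)
    also have "\<dots> = (\<Sum>i\<in>I. y i * (\<Sum>j\<in>I. a i j * y j)) - (\<Sum>i\<in>I. \<mu> * (y i)\<^sup>2)"
      by (simp add: right_diff_distrib sum_subtractf power2_eq_square mult.left_commute)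
    finally show ?thesis by (simp add: quad_form_altdef sum_distrib_left)
  qed
  have b_sym: "b i j = b j i" if "i \<in> I" "j \<in> I" for i j
    using sym[OF that] by (auto simp: b_def)
  have bx: "quad_form I b x = 0" unfolding b_form x by (simp add: \<mu>_def)
  have "(\<Sum>j\<in>I. b i j * x j) = 0" if i: "i \<in> I" for i
  proof (rule linear_coeff_eq_0_if_nonneg)
    fix t :: real
    \<comment> \<open>Along the \<open>i\<close>-th unit vector the linear coefficient is the
      \<open>i\<close>-th entry of \<open>b\<close> applied to \<open>x\<close>.\<close>
    define d :: "'i \<Rightarrow> real" where "d = (\<lambda>k. of_bool (k = i))"
    have "0 \<le> quad_form I b (\<lambda>k. x k + t * d k)"
      unfolding b_form using min by (simp add: \<mu>_def)
    also have "\<dots> = 2 * t * (\<Sum>k\<in>I. d k * (\<Sum>j\<in>I. b k j * x j)) + t\<^sup>2 * quad_form I b d"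
      by (subst quad_form_add_scaled) (auto simp: b_sym bx)
    also have "(\<Sum>k\<in>I. d k * (\<Sum>j\<in>I. b k j * x j)) = (\<Sum>j\<in>I. b i j * x j)"
      unfolding d_def using sum_of_bool_mult(1)[OF assms(1) i] by simp
    finally show "0 \<le> 2 * t * (\<Sum>j\<in>I. b i j * x j) + t\<^sup>2 * quad_form I b d" .
  qed
  hence "(\<Sum>j\<in>I. a i j * x j) = \<mu> * x i" if "i \<in> I" for i
    using b_apply[OF that, of x] that by simp
  moreover have "\<exists>i\<in>I. x i \<noteq> 0"
  proof (rule ccontr)
    assume "\<not> (\<exists>i\<in>I. x i \<noteq> 0)"
    hence "(\<Sum>i\<in>I. (x i)\<^sup>2) = 0" by simp
    thus False using x by simp
  qed
  ultimately show ?thesis using min by (intro that[of x \<mu>]) (auto simp: \<mu>_def)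
qed

section \<open>The least eigenvalue of a symmetric matrix\<close>

text \<open>Translates eigenvectors into the coordinate sums of \<open>quad_form_altdef\<close>. A
  general field is taken because both real and complex matrices occur.\<close>

lemma eigenvalue_iff_sum:
  fixes A :: "'a :: field mat"
  assumes A: "A \<in> carrier_mat n n"
  shows "eigenvalue A k \<longleftrightarrow>
    (\<exists>x. (\<exists>i<n. x i \<noteq> 0) \<and> (\<forall>i<n. (\<Sum>j<n. A $$ (i, j) * x j) = k * x i))"
proof
  assume "eigenvalue A k"
  then obtain v where v: "v \<in> carrier_vec n" "v \<noteq> 0\<^sub>v n" "A *\<^sub>v v = k \<cdot>\<^sub>v v"
    using A by (auto simp: eigenvalue_def eigenvector_def)
  have "\<exists>i<n. v $ i \<noteq> 0"
  proof (rule ccontr)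
    assume "\<not> ?thesis"
    hence "v = 0\<^sub>v n" using v(1) by (intro eq_vecI) auto
    thus False using v(2) by simp
  qed
  moreover have "(\<Sum>j<n. A $$ (i, j) * v $ j) = k * v $ i" if "i < n" for i
  proof -
    have "(A *\<^sub>v v) $ i = (k \<cdot>\<^sub>v v) $ i" using v(3) by simp
    thus ?thesis using that A v(1)
      by (simp add: scalar_prod_def lessThan_atLeast0)
  qed
  ultimately show "\<exists>x. (\<exists>i<n. x i \<noteq> 0) \<and> (\<forall>i<n. (\<Sum>j<n. A $$ (i, j) * x j) = k * x i)"
    by (intro exI[of _ "\<lambda>i. v $ i"]) auto
next
  assume "\<exists>x. (\<exists>i<n. x i \<noteq> 0) \<and> (\<forall>i<n. (\<Sum>j<n. A $$ (i, j) * x j) = k * x i)"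
  then obtain x where x: "\<exists>i<n. x i \<noteq> 0" "\<And>i. i < n \<Longrightarrow> (\<Sum>j<n. A $$ (i, j) * x j) = k * x i"
    by auto
  have "A *\<^sub>v vec n x = k \<cdot>\<^sub>v vec n x"
    using A x(2) by (intro eq_vecI) (auto simp: scalar_prod_def lessThan_atLeast0)
  moreover have "vec n x \<noteq> 0\<^sub>v n"
    using x(1) by (metis index_vec index_zero_vec(1))
  ultimately show "eigenvalue A k"
    using A unfolding eigenvalue_def eigenvector_def by (intro exI[of _ "vec n x"]) auto
qed

text \<open>For an eigenvector \<open>x\<close>, the Hermitian form \<open>q\<close> equals
  \<open>k\<close> times the positive number \<open>s\<close>. Conjugating \<open>q\<close> and
  exchanging the summations gives \<open>q\<close> back, as the entries are real and symmetric;
  hence \<open>q\<close> and \<open>k\<close> are real.\<close>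

lemma symmetric_complex_eigenvalue_real:
  fixes A :: "real mat"
  assumes A: "A \<in> carrier_mat n n"
    and sym: "\<And>i j. i < n \<Longrightarrow> j < n \<Longrightarrow> A $$ (i, j) = A $$ (j, i)"
    and ev: "eigenvalue (map_mat complex_of_real A) k"
  shows "k \<in> \<real>"
proof -
  have "map_mat complex_of_real A \<in> carrier_mat n n" using A by simp
  from ev[unfolded eigenvalue_iff_sum[OF this]] obtain x where nz: "\<exists>i<n. x i \<noteq> 0"
    and "\<And>i. i < n \<Longrightarrow> (\<Sum>j<n. map_mat complex_of_real A $$ (i, j) * x j) = k * x i" by auto
  hence x: "(\<Sum>j<n. of_real (A $$ (i, j)) * x j) = k * x i" if "i < n" for i
    using that A by (auto dest!: meta_spec[of _ i])
  define s where "s = (\<Sum>i<n. (cmod (x i))\<^sup>2)"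
  define q where "q = (\<Sum>i<n. cnj (x i) * (\<Sum>j<n. of_real (A $$ (i, j)) * x j))"
  obtain i where i: "i < n" "x i \<noteq> 0" using nz by auto
  have "0 < (cmod (x i))\<^sup>2" using i by simp
  also have "\<dots> \<le> s" unfolding s_def using i by (intro member_le_sum) auto
  finally have s: "s > 0" .
  have "q = (\<Sum>i<n. k * of_real ((cmod (x i))\<^sup>2))"
    unfolding q_def complex_norm_square by (intro sum.cong refl) (subst x, simp_all)
  also have "\<dots> = k * of_real s" by (simp add: s_def sum_distrib_left)
  finally have q: "q = k * of_real s" .
  have "cnj q = (\<Sum>i<n. \<Sum>j<n. x i * of_real (A $$ (i, j)) * cnj (x j))"
    unfolding q_def by (simp add: sum_distrib_left mult_ac)
  also have "\<dots> = (\<Sum>j<n. \<Sum>i<n. x i * of_real (A $$ (i, j)) * cnj (x j))"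
    by (rule sum.swap)
  also have "\<dots> = q"
    unfolding q_def sum_distrib_left by (intro sum.cong refl) (simp add: sym mult_ac)
  finally have "q \<in> \<real>" by (simp add: Reals_cnj_iff)
  hence "q / of_real s \<in> \<real>" by (intro Reals_divide) auto
  thus ?thesis using q s by simp
qed

text \<open>Over the complex numbers the polynomial splits, and its roots are eigenvalues, hence
  real. The factorization descends because the embedding of real polynomials is injective.\<close>

lemma symmetric_char_poly_splits:
  fixes A :: "real mat"
  assumes A: "A \<in> carrier_mat n n"
    and sym: "\<And>i j. i < n \<Longrightarrow> j < n \<Longrightarrow> A $$ (i, j) = A $$ (j, i)"
  obtains as where "char_poly A = (\<Prod>a\<leftarrow>as. [:- a, 1:])" "length as = n"
proof -
  interpret H: map_poly_inj_idom_hom complex_of_real ..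
  let ?C = "map_mat complex_of_real A"
  have C: "?C \<in> carrier_mat n n" using A by simp
  obtain cs where cs: "char_poly ?C = (\<Prod>a\<leftarrow>cs. [:- a, 1:])" "length cs = n"
    using char_poly_factorized[OF C] by auto
  have real: "c \<in> \<real>" if "c \<in> set cs" for c
  proof (rule symmetric_complex_eigenvalue_real[OF A sym])
    have "poly (char_poly ?C) c = 0"
      unfolding cs(1) using that by (auto simp: poly_prod_list prod_list_zero_iff)
    thus "eigenvalue ?C c" using eigenvalue_root_char_poly[OF C] by simp
  qed
  have "map_poly complex_of_real (char_poly A) = char_poly ?C"
    by (rule of_real_hom.char_poly_hom[OF A, symmetric])
  also have "\<dots> = (\<Prod>a\<leftarrow>cs. map_poly complex_of_real [:- Re a, 1:])"
    unfolding cs(1)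
  proof (intro arg_cong[where f = prod_list] map_cong refl)
    fix c assume "c \<in> set cs"
    from real[OF this] show "[:- c, 1:] = map_poly complex_of_real [:- Re c, 1:]"
      by (simp add: map_poly_pCons)
  qed
  also have "\<dots> = map_poly complex_of_real (\<Prod>a\<leftarrow>map Re cs. [:- a, 1:])"
    by (induction cs) (simp_all add: H.hom_mult del: mult_pCons_left)
  finally have "char_poly A = (\<Prod>a\<leftarrow>map Re cs. [:- a, 1:])"
    by (rule H.injectivity)
  thus ?thesis using cs(2) by (intro that[of "map Re cs"]) auto
qed

text \<open>As the characteristic polynomial splits, the sorted list of real roots has exactly
  \<open>n\<close> entries, so the \<open>n\<close>-th in descending order is the smallest.\<close>

lemma eigenvalue_desc_least:
  fixes A :: "real mat"
  assumes A: "A \<in> carrier_mat n n" and n: "n > 0"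
    and sym: "\<And>i j. i < n \<Longrightarrow> j < n \<Longrightarrow> A $$ (i, j) = A $$ (j, i)"
  shows "eigenvalue A (eigenvalue_desc n A)"
    and "\<And>k. eigenvalue A k \<Longrightarrow> eigenvalue_desc n A \<le> k"
proof -
  obtain as where as: "char_poly A = (\<Prod>a\<leftarrow>as. [:- a, 1:])" "length as = n"
    using symmetric_char_poly_splits[OF A sym] by metis
  have "proots (char_poly A) = mset as"
    unfolding as(1)
    by (induction as) (simp_all add: proots_mult prod_list_zero_iff image_iff del: mult_pCons_left)
  \<comment> \<open>Position \<open>n - 1\<close> of the reversed list is position 0 of the
    ascending one, by the length \<open>n\<close>.\<close>
  hence desc: "eigenvalue_desc n A = sort as ! 0"
    using n as(2) by (simp add: eigenvalue_desc_def rev_nth)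
  have ev: "eigenvalue A k \<longleftrightarrow> k \<in> set as" for k
    unfolding eigenvalue_root_char_poly[OF A] as(1)
    by (auto simp: poly_prod_list prod_list_zero_iff)
  have len: "length (sort as) = n" using as(2) by simp
  show "eigenvalue A (eigenvalue_desc n A)"
    unfolding ev desc using n len by (metis nth_mem set_sort)
  fix k assume "eigenvalue A k"
  then obtain i where "i < n" "sort as ! i = k"
    unfolding ev using len by (metis in_set_conv_nth set_sort)
  thus "eigenvalue_desc n A \<le> k"
    unfolding desc using len by (metis sorted_nth_mono sorted_sort zero_le)
qed

text \<open>The minimum of the form on the unit sphere is an eigenvalue, and the form takes the
  value of the diagonal entry at a unit coordinate vector.\<close>

lemma eigenvalue_desc_least_le_diagonal:
  fixes A :: "real mat"
  assumes A: "A \<in> carrier_mat n n" and i: "i < n"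
    and sym: "\<And>i j. i < n \<Longrightarrow> j < n \<Longrightarrow> A $$ (i, j) = A $$ (j, i)"
  shows "eigenvalue_desc n A \<le> A $$ (i, i)"
proof -
  have "finite {..<n}" "{..<n} \<noteq> {}" using i by auto
  then obtain \<mu> x where nz: "\<exists>i\<in>{..<n}. x i \<noteq> 0"
    and ev: "\<And>i. i \<in> {..<n} \<Longrightarrow> (\<Sum>j<n. A $$ (i, j) * x j) = \<mu> * x i"
    and min: "\<And>y. \<mu> * (\<Sum>i<n. (y i)\<^sup>2) \<le> quad_form {..<n} (\<lambda>i j. A $$ (i, j)) y"
    by (rule symmetric_min_eigenvector_exists[where a = "\<lambda>i j. A $$ (i, j)"]) (use sym in auto)
  have "eigenvalue A \<mu>" unfolding eigenvalue_iff_sum[OF A] using nz ev by auto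
  hence "eigenvalue_desc n A \<le> \<mu>" using i sym by (intro eigenvalue_desc_least(2)[OF A]) auto
  also have "\<mu> \<le> A $$ (i, i)"
    using min[of "\<lambda>k. of_bool (k = i)"] i
      sum_of_bool_mult[of "{..<n}" i]
    by (simp add: quad_form_altdef power2_eq_square flip: of_bool_conj)
  finally show ?thesis .
qed

text \<open>At an eigenvector the form is the eigenvalue times the squared norm, which is positive
  and can be cancelled.\<close>

lemma eigenvalue_desc_least_ge:
  fixes A :: "real mat"
  assumes A: "A \<in> carrier_mat n n" and n: "n > 0"
    and sym: "\<And>i j. i < n \<Longrightarrow> j < n \<Longrightarrow> A $$ (i, j) = A $$ (j, i)"
    and ge: "\<And>x. c * (\<Sum>i<n. (x i)\<^sup>2) \<le> quad_form {..<n} (\<lambda>i j. A $$ (i, j)) x"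
  shows "c \<le> eigenvalue_desc n A"
proof -
  let ?k = "eigenvalue_desc n A"
  have "eigenvalue A ?k" by (rule eigenvalue_desc_least(1)[OF A n sym])
  then obtain x i where i: "i < n" "x i \<noteq> 0"
    and x: "\<And>i. i < n \<Longrightarrow> (\<Sum>j<n. A $$ (i, j) * x j) = ?k * x i"
    unfolding eigenvalue_iff_sum[OF A] by auto
  have "0 < (x i)\<^sup>2" using i by simp
  also have "\<dots> \<le> (\<Sum>i<n. (x i)\<^sup>2)" using i by (intro member_le_sum) auto
  finally have pos: "(\<Sum>i<n. (x i)\<^sup>2) > 0" .
  have "quad_form {..<n} (\<lambda>i j. A $$ (i, j)) x = ?k * (\<Sum>i<n. (x i)\<^sup>2)"
    unfolding quad_form_altdef sum_distrib_left[of ?k]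
    by (intro sum.cong refl) (subst x, simp_all add: power2_eq_square)
  with ge[of x] pos show ?thesis by simp
qed

section \<open>The Motzkin-Straus inequality\<close>

text \<open>Induction on the size of the support of \<open>y\<close>. If the support is a clique,
  Cauchy-Schwarz suffices; otherwise weight moves between two non-adjacent support vertices until
  one drops out. Squaring the total weight on the right makes both sides homogeneous, so no
  normalization is required.\<close>

lemma motzkin_straus:
  fixes y :: "'i \<Rightarrow> real"
  assumes fin: "finite I"
    and sym: "\<And>i j. R i j \<Longrightarrow> R j i" and irrefl: "\<And>i. \<not> R i i"
    and clique: "\<And>S. S \<subseteq> I \<Longrightarrow> (\<And>i j. i \<in> S \<Longrightarrow> j \<in> S \<Longrightarrow> i \<noteq> j \<Longrightarrow> R i j) \<Longrightarrow> card S \<le> k"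
    and nonneg: "\<And>i. i \<in> I \<Longrightarrow> y i \<ge> 0"
  shows "quad_form I (\<lambda>i j. of_bool (R i j)) y \<le> (1 - 1 / real k) * (\<Sum>i\<in>I. y i)\<^sup>2"
  using nonneg
proof (induction "card {i \<in> I. y i \<noteq> 0}" arbitrary: y rule: less_induct)
  case less
  define r :: "'i \<Rightarrow> 'i \<Rightarrow> real" where "r = (\<lambda>i j. of_bool (R i j))"
  define S where "S = {i \<in> I. y i \<noteq> 0}"
  have S: "finite S" "S \<subseteq> I" using fin by (auto simp: S_def)
  show ?case
  proof (cases "\<forall>i\<in>S. \<forall>j\<in>S. i \<noteq> j \<longrightarrow> R i j")
    case True
    hence card: "card S \<le> k" using S by (intro clique) auto
    have sum_S: "(\<Sum>i\<in>I. y i) = (\<Sum>i\<in>S. y i)" "(\<Sum>i\<in>I. (y i)\<^sup>2) = (\<Sum>i\<in>S. (y i)\<^sup>2)"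
      using S fin by (auto intro!: sum.mono_neutral_right simp: S_def)
    \<comment> \<open>All weights are nonnegative and \<open>R\<close> is irreflexive, so the form
      is at most the sum over all off-diagonal pairs.\<close>
    have "quad_form I r y \<le> (\<Sum>i\<in>I. \<Sum>j\<in>I. y i * y j - of_bool (j = i) * (y i * y j))"
      unfolding quad_form_def
      by (intro sum_mono) (auto simp: r_def irrefl less.prems of_bool_def)
    also have "\<dots> = (\<Sum>i\<in>I. y i)\<^sup>2 - (\<Sum>i\<in>I. (y i)\<^sup>2)"
      using sum_of_bool_mult(1)[OF fin]
      by (simp add: sum_subtractf sum_product power2_eq_square)
    finally have le: "quad_form I r y \<le> (\<Sum>i\<in>I. y i)\<^sup>2 - (\<Sum>i\<in>I. (y i)\<^sup>2)" .
    show ?thesis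
    \<comment> \<open>A nonempty support forces \<open>k > 0\<close>, which permits the division by
      \<open>k\<close> below.\<close>
    proof (cases "S = {}")
      case True
      hence "\<forall>i\<in>I. y i = 0" by (auto simp: S_def)
      thus ?thesis by (simp add: quad_form_def)
    next
      case False
      hence cpos: "card S > 0" using S by (simp add: card_gt_0_iff)
      have "(\<Sum>i\<in>S. 1 * y i)\<^sup>2 \<le> (\<Sum>i\<in>S. 1\<^sup>2) * (\<Sum>i\<in>S. (y i)\<^sup>2)"
        by (rule Cauchy_Schwarz_ineq_sum)
      hence "(\<Sum>i\<in>I. y i)\<^sup>2 \<le> real (card S) * (\<Sum>i\<in>I. (y i)\<^sup>2)"
        unfolding sum_S by simp
      also have "\<dots> \<le> real k * (\<Sum>i\<in>I. (y i)\<^sup>2)"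
        using card by (intro mult_right_mono sum_nonneg) auto
      finally have "(\<Sum>i\<in>I. y i)\<^sup>2 / real k \<le> (\<Sum>i\<in>I. (y i)\<^sup>2)"
        using card cpos by (simp add: divide_le_eq mult.commute)
      with le show ?thesis by (simp add: algebra_simps r_def)
    qed
  next
    case False
    \<comment> \<open>\<open>N i\<close> is half the partial derivative of the form at
      \<open>y\<close> in coordinate \<open>i\<close>. Swapping names if necessary, \<open>u\<close>
      is the vertex where it is at least as large.\<close>
    define N where "N = (\<lambda>i. \<Sum>j\<in>I. r i j * y j)"
    obtain u v where uv: "u \<in> S" "v \<in> S" "u \<noteq> v" "\<not> R u v" "N v \<le> N u"
    proof -
      obtain u v where uv: "u \<in> S" "v \<in> S" "u \<noteq> v" "\<not> R u v" using False by auto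
      show ?thesis using that[of u v] that[of v u] uv sym[of v u] linear[of "N v" "N u"] by blast
    qed
    have uvI: "u \<in> I" "v \<in> I" using uv S by auto
    \<comment> \<open>As \<open>u\<close> and \<open>v\<close> are not adjacent, the form is affine along \<open>d\<close>, so all the weight
      of \<open>v\<close> can be moved to \<open>u\<close> without decreasing it.\<close>
    define d :: "'i \<Rightarrow> real" where "d = (\<lambda>i. of_bool (i = u) - of_bool (i = v))"
    define z where "z = (\<lambda>i. y i + y v * d i)"
    have d_sum: "(\<Sum>i\<in>I. d i * f i) = f u - f v" for f :: "'i \<Rightarrow> real"
      using sum_of_bool_mult(1)[OF fin uvI(1), of f] sum_of_bool_mult(1)[OF fin uvI(2), of f]
      by (simp add: d_def left_diff_distrib sum_subtractf)
    have d_sum': "(\<Sum>i\<in>I. f i * d i) = f u - f v" for f :: "'i \<Rightarrow> real"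
      using d_sum[of f] by (simp add: mult.commute)
    have "quad_form I r d = 0"
      unfolding quad_form_altdef d_sum d_sum' using uv sym irrefl by (auto simp: r_def)
    moreover have "r i j = r j i" for i j using sym by (auto simp: r_def)
    ultimately have "quad_form I r z = quad_form I r y + 2 * y v * (N u - N v)"
      unfolding z_def by (subst quad_form_add_scaled) (auto simp: d_sum N_def)
    hence "quad_form I r y \<le> quad_form I r z"
      using uv(5) less.prems[OF uvI(2)] by simp
    also have "\<dots> \<le> (1 - 1 / real k) * (\<Sum>i\<in>I. z i)\<^sup>2"
      unfolding r_def
    proof (rule less.hyps)
      \<comment> \<open>\<open>v\<close> loses all its weight and \<open>u\<close> already carried
        some, so the support shrinks strictly.\<close>
      have "{i \<in> I. z i \<noteq> 0} \<subseteq> S - {v}"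
        using uv by (auto simp: z_def d_def S_def split: if_splits)
      hence "card {i \<in> I. z i \<noteq> 0} \<le> card (S - {v})" using S by (intro card_mono) auto
      also have "\<dots> < card S" using S uv by (intro psubset_card_mono) auto
      finally show "card {i \<in> I. z i \<noteq> 0} < card {i \<in> I. y i \<noteq> 0}" unfolding S_def .
      show "z i \<ge> 0" if "i \<in> I" for i
        using less.prems[OF that] less.prems[OF uvI(2)] by (auto simp: z_def d_def)
    qed
    also have "(\<Sum>i\<in>I. z i) = (\<Sum>i\<in>I. y i)"
      using d_sum[of "\<lambda>_. 1"] by (simp add: z_def sum.distrib flip: sum_distrib_left)
    finally show ?thesis by (simp add: r_def)
  qed
qed

text \<open>Motzkin-Straus demands nonnegative weights, while \<open>x\<close> may have any signs.
  Cauchy-Schwarz over related pairs passes to the same form at the squares, whose total weight is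
  the squared norm.\<close>

lemma abs_quad_form_relation_le:
  fixes x :: "'i \<Rightarrow> real"
  assumes fin: "finite I"
    and sym: "\<And>i j. R i j \<Longrightarrow> R j i" and irrefl: "\<And>i. \<not> R i i"
    and clique: "\<And>S. S \<subseteq> I \<Longrightarrow> (\<And>i j. i \<in> S \<Longrightarrow> j \<in> S \<Longrightarrow> i \<noteq> j \<Longrightarrow> R i j) \<Longrightarrow> card S \<le> k"
    and pairs: "card {(i, j) \<in> I \<times> I. R i j} \<le> p" and k: "k > 0"
  shows "\<bar>quad_form I (\<lambda>i j. of_bool (R i j)) x\<bar>
    \<le> sqrt (real p * (1 - 1 / real k)) * (\<Sum>i\<in>I. (x i)\<^sup>2)"
proof -
  define P where "P = {(i, j) \<in> I \<times> I. R i j}"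
  define r :: "'i \<Rightarrow> 'i \<Rightarrow> real" where "r = (\<lambda>i j. of_bool (R i j))"
  define s where "s = (\<Sum>i\<in>I. (x i)\<^sup>2)"
  have s: "s \<ge> 0" unfolding s_def by (intro sum_nonneg) auto
  have form: "quad_form I r w = (\<Sum>(i,j)\<in>P. w i * w j)" for w
  proof -
    have "quad_form I r w = (\<Sum>(i,j)\<in>I\<times>I. r i j * w i * w j)"
      unfolding quad_form_def by (simp add: sum.cartesian_product)
    also have "\<dots> = (\<Sum>(i,j)\<in>P. w i * w j)"
      unfolding P_def using fin by (intro sum.mono_neutral_cong_right) (auto simp: r_def)
    finally show ?thesis .
  qed
  have "(quad_form I r x)\<^sup>2 = (\<Sum>p\<in>P. 1 * (x (fst p) * x (snd p)))\<^sup>2"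
    unfolding form by (simp add: case_prod_unfold)
  also have "\<dots> \<le> (\<Sum>p\<in>P. 1\<^sup>2) * (\<Sum>p\<in>P. (x (fst p) * x (snd p))\<^sup>2)"
    by (rule Cauchy_Schwarz_ineq_sum)
  also have "\<dots> = real (card P) * quad_form I r (\<lambda>i. (x i)\<^sup>2)"
    unfolding form by (simp add: case_prod_unfold power_mult_distrib)
  also have "\<dots> \<le> real p * ((1 - 1 / real k) * s\<^sup>2)"
  proof (intro mult_mono)
    show "quad_form I r (\<lambda>i. (x i)\<^sup>2) \<le> (1 - 1 / real k) * s\<^sup>2"
      unfolding r_def s_def by (intro motzkin_straus[OF fin sym irrefl clique]) auto
    show "0 \<le> quad_form I r (\<lambda>i. (x i)\<^sup>2)"
      unfolding form by (intro sum_nonneg) auto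
  qed (use pairs in \<open>auto simp: P_def\<close>)
  also have "\<dots> = (real p * (1 - 1 / real k)) * s\<^sup>2" by simp
  finally have "\<bar>quad_form I r x\<bar> \<le> sqrt ((real p * (1 - 1 / real k)) * s\<^sup>2)"
    by (intro real_le_rsqrt) simp
  also have "\<dots> = sqrt (real p * (1 - 1 / real k)) * s"
    using s by (simp add: real_sqrt_mult)
  finally show ?thesis unfolding r_def s_def .
qed

section \<open>Graphs\<close>

lemma simple_graph_finite_edges: "simple_graph V E \<Longrightarrow> finite E"
  by (rule finite_subset[of _ "Pow V"]) (auto simp: simple_graph_def)

lemma simple_graph_no_loop: "simple_graph V E \<Longrightarrow> {v} \<notin> E"
  by (auto simp: simple_graph_def)

lemma clique_card_le_clique_number:
  assumes "simple_graph V E" "is_clique V E C"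
  shows "card C \<le> clique_number V E"
proof -
  have "finite {C. is_clique V E C}"
    by (rule finite_subset[of _ "Pow V"]) (use assms in \<open>auto simp: is_clique_def simple_graph_def\<close>)
  thus ?thesis unfolding clique_number_def using assms by (intro Max_ge) auto
qed

lemma clique_number_pos:
  assumes "simple_graph V E"
  shows "clique_number V E > 0"
proof -
  obtain v where "v \<in> V" using assms by (auto simp: simple_graph_def)
  hence "is_clique V E {v}" by (auto simp: is_clique_def)
  from clique_card_le_clique_number[OF assms this] show ?thesis by simp
qed

lemma min_degree_le: "simple_graph V E \<Longrightarrow> v \<in> V \<Longrightarrow> min_degree V E \<le> vertex_degree E v"
  unfolding min_degree_def by (intro Min_le) (auto simp: simple_graph_def)

lemma min_degree_attained:
  assumes "simple_graph V E"
  obtains v where "v \<in> V" "min_degree V E = vertex_degree E v"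
proof -
  have "min_degree V E \<in> vertex_degree E ` V"
    unfolding min_degree_def using assms by (intro Min_in) (auto simp: simple_graph_def)
  thus ?thesis using that by auto
qed

text \<open>Grouping ordered pairs by the edge they span, each edge \<open>{a, b}\<close> receives
  only \<open>(a, b)\<close> and \<open>(b, a)\<close>.\<close>

lemma card_adjacent_pairs_le:
  assumes "simple_graph V E"
  shows "card {(u, v) \<in> V \<times> V. {u, v} \<in> E} \<le> 2 * card E"
proof -
  have fin: "finite E" by (rule simple_graph_finite_edges[OF assms])
  \<comment> \<open>Finiteness is carried along because \<open>card_mono\<close> requires the union
    of these fibres to be finite.\<close>
  have pairs: "finite {(u, v). {u, v} = e} \<and> card {(u, v). {u, v} = e} \<le> 2" if "e \<in> E" for e
  proof -
    have "card e = 2" using assms that by (auto simp: simple_graph_def)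
    then obtain a b where ab: "e = {a, b}" by (auto simp: card_2_iff)
    have "{(u, v). {u, v} = e} \<subseteq> {(a, b), (b, a)}"
      unfolding ab by (auto simp: doubleton_eq_iff)
    moreover have "card {(a, b), (b, a)} \<le> 2" by (cases "a = b") auto
    ultimately show ?thesis
      by (meson card_mono finite.emptyI finite.insertI finite_subset le_trans)
  qed
  have "card {(u, v) \<in> V \<times> V. {u, v} \<in> E} \<le> card (\<Union>e\<in>E. {(u, v). {u, v} = e})"
    using fin pairs by (intro card_mono) auto
  also have "\<dots> \<le> (\<Sum>e\<in>E. card {(u, v). {u, v} = e})" by (rule card_UN_le[OF fin])
  also have "\<dots> \<le> (\<Sum>e\<in>E. 2)" using pairs by (intro sum_mono) auto
  finally show ?thesis by simp
qed

text \<open>The enumeration is injective, so index cliques map to vertex cliques of equal size, and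
  related index pairs inject into adjacent vertex pairs.\<close>

lemma abs_adjacency_form_le:
  assumes G: "simple_graph V E" and vs: "distinct vs" "set vs = V"
  shows "\<bar>quad_form {..<length vs} (\<lambda>i j. of_bool ({vs ! i, vs ! j} \<in> E)) x\<bar>
    \<le> sqrt (2 * real (card E) * (1 - 1 / real (clique_number V E))) * (\<Sum>i<length vs. (x i)\<^sup>2)"
proof -
  let ?I = "{..<length vs}" and ?R = "\<lambda>i j. {vs ! i, vs ! j} \<in> E"
  have inj: "inj_on ((!) vs) ?I" using vs(1) by (simp add: inj_on_nth)
  have "\<bar>quad_form ?I (\<lambda>i j. of_bool (?R i j)) x\<bar>
    \<le> sqrt (real (2 * card E) * (1 - 1 / real (clique_number V E))) * (\<Sum>i\<in>?I. (x i)\<^sup>2)"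
  proof (rule abs_quad_form_relation_le)
    show "?R j i" if "?R i j" for i j using that by (simp add: insert_commute)
    show "\<not> ?R i i" for i using simple_graph_no_loop[OF G] by simp
    show "clique_number V E > 0" by (rule clique_number_pos[OF G])
    show "card S \<le> clique_number V E"
      if S: "S \<subseteq> ?I" and R: "\<And>i j. i \<in> S \<Longrightarrow> j \<in> S \<Longrightarrow> i \<noteq> j \<Longrightarrow> ?R i j" for S
    proof -
      have "is_clique V E ((!) vs ` S)"
        unfolding is_clique_def using S vs(2) by (auto intro!: R)
      hence "card ((!) vs ` S) \<le> clique_number V E" by (rule clique_card_le_clique_number[OF G])
      thus ?thesis using card_image[OF inj_on_subset[OF inj S]] by simp
    qed
    have "card {(i, j) \<in> ?I \<times> ?I. ?R i j} \<le> card {(u, v) \<in> V \<times> V. {u, v} \<in> E}"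
    proof (rule card_inj_on_le)
      show "inj_on (map_prod ((!) vs) ((!) vs)) {(i, j) \<in> ?I \<times> ?I. ?R i j}"
        by (rule inj_on_subset[OF map_prod_inj_on[OF inj inj]]) auto
      show "map_prod ((!) vs) ((!) vs) ` {(i, j) \<in> ?I \<times> ?I. ?R i j}
        \<subseteq> {(u, v) \<in> V \<times> V. {u, v} \<in> E}"
        using vs(2) by auto
      show "finite {(u, v) \<in> V \<times> V. {u, v} \<in> E}"
        by (rule finite_subset[of _ "V \<times> V"]) (use G in \<open>auto simp: simple_graph_def\<close>)
    qed
    also have "\<dots> \<le> 2 * card E" by (rule card_adjacent_pairs_le[OF G])
    finally show "card {(i, j) \<in> ?I \<times> ?I. ?R i j} \<le> 2 * card E" .
  qed auto
  thus ?thesis by simp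
qed

section \<open>The matrix \<open>A_alpha\<close> and the two bounds\<close>

lemma A_alpha_carrier: "A_alpha \<alpha> vs E \<in> carrier_mat (length vs) (length vs)"
  by (simp add: A_alpha_def degree_matrix_def adjacency_matrix_def)

text \<open>The delta is written \<open>j = i\<close> so that \<open>sum_of_bool_mult\<close>
  collapses row sums. On the diagonal the last term tests for a loop.\<close>

lemma A_alpha_index:
  assumes "i < length vs" "j < length vs"
  shows "A_alpha \<alpha> vs E $$ (i, j) =
    \<alpha> * real (vertex_degree E (vs ! i)) * of_bool (j = i)
      + (1 - \<alpha>) * of_bool ({vs ! i, vs ! j} \<in> E)"
  using assms by (auto simp: A_alpha_def degree_matrix_def adjacency_matrix_def)

lemma A_alpha_symmetric:
  assumes "i < length vs" "j < length vs"
  shows "A_alpha \<alpha> vs E $$ (i, j) = A_alpha \<alpha> vs E $$ (j, i)"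
  using assms by (auto simp: A_alpha_index insert_commute)

lemma A_alpha_form:
  "quad_form {..<length vs} (\<lambda>i j. A_alpha \<alpha> vs E $$ (i, j)) x =
    \<alpha> * (\<Sum>i<length vs. real (vertex_degree E (vs ! i)) * (x i)\<^sup>2)
      + (1 - \<alpha>) * quad_form {..<length vs} (\<lambda>i j. of_bool ({vs ! i, vs ! j} \<in> E)) x"
proof -
  have "(\<Sum>j<length vs. A_alpha \<alpha> vs E $$ (i, j) * x j) =
    \<alpha> * real (vertex_degree E (vs ! i)) * x i
      + (1 - \<alpha>) * (\<Sum>j<length vs. of_bool ({vs ! i, vs ! j} \<in> E) * x j)"
    if "i < length vs" for i
  proof -
    have "(\<Sum>j<length vs. A_alpha \<alpha> vs E $$ (i, j) * x j) =
      (\<Sum>j<length vs. \<alpha> * real (vertex_degree E (vs ! i)) * (of_bool (j = i) * x j)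
        + (1 - \<alpha>) * (of_bool ({vs ! i, vs ! j} \<in> E) * x j))"
      using that by (intro sum.cong refl) (simp add: A_alpha_index algebra_simps)
    also have "\<dots> = \<alpha> * real (vertex_degree E (vs ! i)) * (\<Sum>j<length vs. of_bool (j = i) * x j)
      + (1 - \<alpha>) * (\<Sum>j<length vs. of_bool ({vs ! i, vs ! j} \<in> E) * x j)"
      by (simp only: sum.distrib sum_distrib_left)
    finally show ?thesis
      using sum_of_bool_mult(1)[of "{..<length vs}" i x] that by simp
  qed
  thus ?thesis
    unfolding quad_form_altdef
    by (simp add: distrib_left sum.distrib sum_distrib_left power2_eq_square mult_ac)
qed

theorem theorem3p9:
  fixes V :: "'a set" and E :: "'a set set" and vs :: "'a list" and \<alpha> :: real
  assumes "simple_graph V E"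
    and "distinct vs" and "set vs = V"
    and "0 \<le> \<alpha>" and "\<alpha> \<le> 1"
  shows "\<alpha> * real (min_degree V E)
           - sqrt (2 * real (card E) * (1 - \<alpha>) * (1 - 1 / real (clique_number V E)))
         \<le> eigenvalue_desc (card V) (A_alpha \<alpha> vs E)
       \<and> eigenvalue_desc (card V) (A_alpha \<alpha> vs E)
         \<le> \<alpha> * real (min_degree V E)
           + sqrt (2 * real (card E) * (1 - \<alpha>) * (1 - 1 / real (clique_number V E)))"
proof
  let ?n = "length vs" and ?A = "A_alpha \<alpha> vs E"
  let ?Q = "quad_form {..<length vs} (\<lambda>i j. of_bool ({vs ! i, vs ! j} \<in> E))"
  let ?\<delta> = "real (min_degree V E)"
  define c where "c = 2 * real (card E) * (1 - 1 / real (clique_number V E))"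
  have c: "c \<ge> 0"
    using clique_number_pos[OF assms(1)] by (simp add: c_def)
  have c_eq: "2 * real (card E) * (1 - \<alpha>) * (1 - 1 / real (clique_number V E)) = (1 - \<alpha>) * c"
    by (simp add: c_def)
  have n: "card V = ?n" "?n > 0"
    using assms distinct_card[of vs] by (auto simp: simple_graph_def)
  \<comment> \<open>The form estimate produces \<open>(1 - \<alpha>) * sqrt c\<close>; since
    \<open>1 - \<alpha>\<close> lies in [0,1], this is at most the claimed root, where the factor
    appears only to the first power.\<close>
  have "(1 - \<alpha>)\<^sup>2 \<le> (1 - \<alpha>)"
    using assms(4,5) by (simp add: power2_eq_square mult_left_le)
  hence sqrt_le: "(1 - \<alpha>) * sqrt c \<le> sqrt ((1 - \<alpha>) * c)"
    using c by (intro real_le_rsqrt) (simp add: power_mult_distrib mult_right_mono)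

  show "\<alpha> * ?\<delta> - sqrt (2 * real (card E) * (1 - \<alpha>) * (1 - 1 / real (clique_number V E)))
    \<le> eigenvalue_desc (card V) ?A"
    unfolding c_eq n(1)
  \<comment> \<open>The degree part contributes at least \<open>\<alpha> * ?\<delta> * ?s\<close>,
    the adjacency part at least \<open>- (1 - \<alpha>) * sqrt c * ?s\<close>.\<close>
  proof (rule eigenvalue_desc_least_ge[OF A_alpha_carrier n(2) A_alpha_symmetric])
    fix x :: "nat \<Rightarrow> real"
    let ?s = "\<Sum>i<?n. (x i)\<^sup>2"
    have s: "?s \<ge> 0" by (intro sum_nonneg) auto
    have "?\<delta> \<le> real (vertex_degree E (vs ! i))" if "i < ?n" for i
      using min_degree_le[OF assms(1), of "vs ! i"] nth_mem[OF that] unfolding assms(3) by simp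
    hence "?\<delta> * ?s \<le> (\<Sum>i<?n. real (vertex_degree E (vs ! i)) * (x i)\<^sup>2)"
      unfolding sum_distrib_left by (intro sum_mono mult_right_mono) auto
    hence deg: "\<alpha> * (?\<delta> * ?s) \<le> \<alpha> * (\<Sum>i<?n. real (vertex_degree E (vs ! i)) * (x i)\<^sup>2)"
      using assms(4) by (rule mult_left_mono)
    have "- (sqrt c * ?s) \<le> ?Q x"
      using abs_adjacency_form_le[OF assms(1-3), of x] unfolding c_def by linarith
    hence "(1 - \<alpha>) * (- (sqrt c * ?s)) \<le> (1 - \<alpha>) * ?Q x"
      using assms(5) by (intro mult_left_mono) auto
    moreover have "(1 - \<alpha>) * sqrt c * ?s \<le> sqrt ((1 - \<alpha>) * c) * ?s"
      using sqrt_le s by (rule mult_right_mono)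
    ultimately show "(\<alpha> * ?\<delta> - sqrt ((1 - \<alpha>) * c)) * ?s
      \<le> quad_form {..<?n} (\<lambda>i j. ?A $$ (i, j)) x"
      unfolding A_alpha_form using deg by (simp add: algebra_simps)
  qed

  \<comment> \<open>For the upper bound, the diagonal entry at a vertex of minimum degree is exactly
    \<open>\<alpha> * ?\<delta>\<close>, as there are no loops; the root then adds a nonnegative
    amount.\<close>
  obtain v where v: "v \<in> V" "min_degree V E = vertex_degree E v"
    using min_degree_attained[OF assms(1)] .
  then obtain i where i: "i < ?n" "vs ! i = v"
    using assms(3) by (metis in_set_conv_nth)
  have "eigenvalue_desc ?n ?A \<le> ?A $$ (i, i)"
    by (rule eigenvalue_desc_least_le_diagonal[OF A_alpha_carrier i(1) A_alpha_symmetric])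
  also have "\<dots> = \<alpha> * ?\<delta>"
    using i v(2) simple_graph_no_loop[OF assms(1)] by (simp add: A_alpha_index)
  also have "\<dots> \<le> \<alpha> * ?\<delta> + sqrt ((1 - \<alpha>) * c)"
    using assms(5) c by simp
  finally show "eigenvalue_desc (card V) ?A \<le> \<alpha> * ?\<delta>
    + sqrt (2 * real (card E) * (1 - \<alpha>) * (1 - 1 / real (clique_number V E)))"
    unfolding c_eq n(1) .
qed

end
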